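(* Let $\kappa>0$, $\phi>0$, $A>0$, $T>0$ and $E_0\in\mathbb{R}$. For any $\alpha\in\mathbb{R}$, the boundary value problem $$ \left\{\begin{array}{l} 0=2\kappa E''(t)+\alpha E'(t)-2\phi E(t)\qquad \text{for } t\in(0,T),\\ E(0)=E_0,\qquad \kappa E'(T)+A E(T)=0, \end{array}\right. $$ has a unique solution $E$, given by $$ E(t)=E_0\, a\left(\exp\{r_+t\}-\exp\{r_-t\}\right)+E_0\exp\{r_-t\}, $$ where $$ a=\frac{(\alpha/4+\kappa\theta-A)\exp\{-\theta T\}}{-\frac{\alpha}{2}\sinh(\theta T)+2\kappa\theta\cosh(\theta T)+2A\sinh(\theta T)}, $$ the denominator being positive, and $$ r_\pm:=-\frac{\alpha}{4\kappa}\pm\theta,\qquad \theta:=\frac1\kappa\sqrt{\kappa\phi+\frac{\alpha^2}{16}}. $$ Moreover, the solution $h_2$ on $[0,T]$ of $$ 4\kappa\phi=-2\kappa h_2'(t)+(h_2(t))^2,\qquad h_2(T)=2A, $$ is given by $$ h_2(t)=2\sqrt{\kappa\phi}\,\frac{1+c_2e^{rt}}{1-c_2e^{rt}}, \qquad r=2\sqrt{\phi/\kappa},\qquad c_2=-\frac{1-A/\sqrt{\kappa\phi}}{1+A/\sqrt{\kappa\phi}}\cdot e^{-rT}. $$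
   Context: Here $E(t)$ is interpreted as the net inventory at time $t$ of a continuum of traders with identical preferences, $\alpha$ as the permanent market impact coefficient, $\kappa$ as the temporary market impact coefficient, $\phi$ as the risk aversion, $A$ as the terminal penalization and $T$ as the horizon. These interpretations are not needed for the mathematical statement. *)

theory Defs
  imports Complex_Main
begin

(* Classical solution on [0,T]; only the values of E on [0,T] matter (E is total in HOL).
   E is continuous on [0,T] and twice differentiable on (0,T).  E' is the derivative of E on
   (0,T], where at T it is the one-sided (left) derivative, since "within {0..T}" is used. *)
definition solves_inventory_bvp ::
    "real \<Rightarrow> real \<Rightarrow> real \<Rightarrow> real \<Rightarrow> real \<Rightarrow> real \<Rightarrow> (real \<Rightarrow> real) \<Rightarrow> bool" where
  "solves_inventory_bvp \<kappa> \<phi> A T E0 \<alpha> E \<longleftrightarrow>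
     continuous_on {0..T} E \<and>
     (\<exists>E' E''.
        (\<forall>t\<in>{0<..T}. (E has_real_derivative E' t) (at t within {0..T})) \<and>
        (\<forall>t\<in>{0<..<T}. (E' has_real_derivative E'' t) (at t)) \<and>
        (\<forall>t\<in>{0<..<T}. 0 = 2 * \<kappa> * E'' t + \<alpha> * E' t - 2 * \<phi> * E t) \<and>
        E 0 = E0 \<and> \<kappa> * E' T + A * E T = 0)"

(* One-sided derivatives at 0 and at T. *)
definition solves_h2_equation ::
    "real \<Rightarrow> real \<Rightarrow> real \<Rightarrow> real \<Rightarrow> (real \<Rightarrow> real) \<Rightarrow> bool" where
  "solves_h2_equation \<kappa> \<phi> A T h \<longleftrightarrow>
     (\<exists>h'. \<forall>t\<in>{0..T}. (h has_real_derivative h' t) (at t within {0..T}) \<and>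
            4 * \<kappa> * \<phi> = - 2 * \<kappa> * h' t + (h t)\<^sup>2) \<and>
     h T = 2 * A"

definition theta :: "real \<Rightarrow> real \<Rightarrow> real \<Rightarrow> real" where
  "theta \<kappa> \<phi> \<alpha> = 1 / \<kappa> * sqrt (\<kappa> * \<phi> + \<alpha>\<^sup>2 / 16)"

definition r_plus :: "real \<Rightarrow> real \<Rightarrow> real \<Rightarrow> real" where
  "r_plus \<kappa> \<phi> \<alpha> = - \<alpha> / (4 * \<kappa>) + theta \<kappa> \<phi> \<alpha>"

definition r_minus :: "real \<Rightarrow> real \<Rightarrow> real \<Rightarrow> real" where
  "r_minus \<kappa> \<phi> \<alpha> = - \<alpha> / (4 * \<kappa>) - theta \<kappa> \<phi> \<alpha>"

definition a_denom :: "real \<Rightarrow> real \<Rightarrow> real \<Rightarrow> real \<Rightarrow> real \<Rightarrow> real" where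
  "a_denom \<kappa> \<phi> A T \<alpha> =
     - (\<alpha> / 2) * sinh (theta \<kappa> \<phi> \<alpha> * T)
     + 2 * \<kappa> * theta \<kappa> \<phi> \<alpha> * cosh (theta \<kappa> \<phi> \<alpha> * T)
     + 2 * A * sinh (theta \<kappa> \<phi> \<alpha> * T)"

definition a_coeff :: "real \<Rightarrow> real \<Rightarrow> real \<Rightarrow> real \<Rightarrow> real \<Rightarrow> real" where
  "a_coeff \<kappa> \<phi> A T \<alpha> =
     (\<alpha> / 4 + \<kappa> * theta \<kappa> \<phi> \<alpha> - A) * exp (- theta \<kappa> \<phi> \<alpha> * T) / a_denom \<kappa> \<phi> A T \<alpha>"

definition inventory :: "real \<Rightarrow> real \<Rightarrow> real \<Rightarrow> real \<Rightarrow> real \<Rightarrow> real \<Rightarrow> real \<Rightarrow> real" where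
  "inventory \<kappa> \<phi> A T E0 \<alpha> t =
     E0 * a_coeff \<kappa> \<phi> A T \<alpha> * (exp (r_plus \<kappa> \<phi> \<alpha> * t) - exp (r_minus \<kappa> \<phi> \<alpha> * t))
     + E0 * exp (r_minus \<kappa> \<phi> \<alpha> * t)"

definition h2_rate :: "real \<Rightarrow> real \<Rightarrow> real" where
  "h2_rate \<kappa> \<phi> = 2 * sqrt (\<phi> / \<kappa>)"

definition c2 :: "real \<Rightarrow> real \<Rightarrow> real \<Rightarrow> real \<Rightarrow> real" where
  "c2 \<kappa> \<phi> A T =
     - ((1 - A / sqrt (\<kappa> * \<phi>)) / (1 + A / sqrt (\<kappa> * \<phi>))) * exp (- h2_rate \<kappa> \<phi> * T)"

definition h2 :: "real \<Rightarrow> real \<Rightarrow> real \<Rightarrow> real \<Rightarrow> real \<Rightarrow> real" where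
  "h2 \<kappa> \<phi> A T t =
     2 * sqrt (\<kappa> * \<phi>) * ((1 + c2 \<kappa> \<phi> A T * exp (h2_rate \<kappa> \<phi> * t)) /
                          (1 - c2 \<kappa> \<phi> A T * exp (h2_rate \<kappa> \<phi> * t)))"

end

theory Submission
  imports Defs
begin

text \<open>
  The roots \<open>r\<^sub>\<plusminus>\<close> of the characteristic polynomial are real and distinct, and along a solution both
  \<open>(E' - r\<^sub>- E) exp (- r\<^sub>+ t)\<close> and \<open>(E' - r\<^sub>+ E) exp (- r\<^sub>- t)\<close> are constant, so \<open>E\<close> is a combination of two
  exponentials on the open interval and, by continuity, on the closed one. The boundary conditions
  are then a linear system with determinant proportional to the denominator of \<open>a\<close>.
  For the Riccati equation, the difference \<open>d\<close> of two solutions satisfies \<open>d' = p d\<close> with \<open>p\<close> bounded,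
  \<open>\<bar>p\<bar> \<le> M\<close>, so \<open>d\<^sup>2 exp (2 M t)\<close> is nondecreasing; it vanishes at \<open>T\<close>, hence everywhere.
\<close>

section \<open>Functions and linear differential equations on a closed interval\<close>

text \<open>By continuity each endpoint value is a one-sided limit of a function that is eventually
  zero. This carries identities from the open interval, where the second-order equation holds, to
  the endpoints, where the boundary conditions live.\<close>

lemma continuous_on_Icc_eq_zeroI:
  fixes f :: "real \<Rightarrow> real"
  assumes "a < b" and cont: "continuous_on {a..b} f"
    and zero: "\<And>t. t \<in> {a<..<b} \<Longrightarrow> f t = 0" and t: "t \<in> {a..b}"
  shows "f t = 0"
proof -
  have "eventually (\<lambda>t. f t = 0) (at_left b)"
    using eventually_at_left_real[OF \<open>a < b\<close>] by eventually_elim (rule zero)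
  then have "(f \<longlongrightarrow> 0) (at_left b)" by (simp add: tendsto_eventually)
  then have b: "f b = 0"
    using continuous_on_Icc_at_leftD[OF cont \<open>a < b\<close>] tendsto_unique trivial_limit_at_left_real by blast
  have "eventually (\<lambda>t. f t = 0) (at_right a)"
    using eventually_at_right_real[OF \<open>a < b\<close>] by eventually_elim (rule zero)
  then have "(f \<longlongrightarrow> 0) (at_right a)" by (simp add: tendsto_eventually)
  then have a: "f a = 0"
    using continuous_on_Icc_at_rightD[OF cont \<open>a < b\<close>] tendsto_unique trivial_limit_at_right_real by blast
  show ?thesis
  proof (cases "t = a \<or> t = b")
    case False
    then show ?thesis using t by (intro zero) auto
  qed (use a b in auto)
qed

text \<open>The right endpoint is a limit point of the interval, so the difference quotient has at
  most one limit there. This pins down the value \<open>E' T\<close>, which is only a one-sided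
  derivative.\<close>

lemma has_real_derivative_unique_right_endpoint:
  fixes f :: "real \<Rightarrow> real"
  assumes "a < b" and "(f has_real_derivative D) (at b within {a..b})"
    and "(f has_real_derivative D') (at b within {a..b})"
  shows "D = D'"
proof -
  have "at b within {a..b} \<noteq> bot"
    using at_within_Icc_at_left[OF \<open>a < b\<close>] trivial_limit_at_left_real by metis
  then show ?thesis
    using assms(2,3) unfolding has_field_derivative_iff by (rule tendsto_unique)
qed

lemma second_order_solution_exp:
  fixes E E' E'' :: "real \<Rightarrow> real"
  assumes "a < b" and "p \<noteq> q" and cont: "continuous_on {a..b} E"
    and E: "\<And>t. t \<in> {a<..<b} \<Longrightarrow> (E has_real_derivative E' t) (at t)"
    and E': "\<And>t. t \<in> {a<..<b} \<Longrightarrow> (E' has_real_derivative E'' t) (at t)"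
    and ode: "\<And>t. t \<in> {a<..<b} \<Longrightarrow> E'' t = (p + q) * E' t - p * q * E t"
  obtains P Q where "\<And>t. t \<in> {a..b} \<Longrightarrow> E t = P * exp (p * t) + Q * exp (q * t)"
proof -
  \<comment> \<open>Each factorization of the characteristic polynomial gives a first integral.
    Fixing only the sum and the product of \<open>u\<close> and \<open>v\<close> allows a second use
    with the roots exchanged.\<close>
  have const: "\<exists>c. \<forall>t\<in>{a<..<b}. E' t - v * E t = c * exp (u * t)"
    if uv: "u + v = p + q" "u * v = p * q" for u v
  proof -
    define w where "w = (\<lambda>t. (E' t - v * E t) * exp (- u * t))"
    have dw: "(w has_real_derivative 0) (at t)" if t: "t \<in> {a<..<b}" for t
    proof -
      have "(w has_real_derivative
          (E'' t - v * E' t) * exp (- u * t) + (E' t - v * E t) * (exp (- u * t) * (- u))) (at t)"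
        unfolding w_def by (auto intro!: derivative_eq_intros E[OF t] E'[OF t])
      moreover have "E'' t = (u + v) * E' t - u * v * E t"
        unfolding uv by (rule ode[OF t])
      ultimately show ?thesis by (simp add: algebra_simps)
    qed
    define m where "m = (a + b) / 2"
    have m: "m \<in> {a<..<b}" using \<open>a < b\<close> by (auto simp: m_def)
    have "E' t - v * E t = w m * exp (u * t)" if t: "t \<in> {a<..<b}" for t
    proof -
      have "w t = w m"
        by (rule DERIV_isconst3[OF \<open>a < b\<close> t m dw]) auto
      then show ?thesis by (simp add: w_def exp_minus field_simps)
    qed
    then show ?thesis by blast
  qed
  obtain c where c: "\<forall>t\<in>{a<..<b}. E' t - q * E t = c * exp (p * t)"
    using const[of p q] by auto
  obtain d where d: "\<forall>t\<in>{a<..<b}. E' t - p * E t = d * exp (q * t)"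
    using const[OF add.commute mult.commute] by auto
  define P Q where "P = c / (p - q)" and "Q = - d / (p - q)"
  define f where "f = (\<lambda>t. E t - (P * exp (p * t) + Q * exp (q * t)))"
  have "f t = 0" if t: "t \<in> {a..b}" for t
  proof (rule continuous_on_Icc_eq_zeroI[OF \<open>a < b\<close> _ _ t])
    show "continuous_on {a..b} f"
      unfolding f_def by (intro continuous_intros cont)
    fix s assume "s \<in> {a<..<b}"
    \<comment> \<open>Subtracting the two first integrals eliminates \<open>E'\<close>.\<close>
    then have "E s * (p - q) = c * exp (p * s) - d * exp (q * s)"
      using bspec[OF c, of s] bspec[OF d, of s] by (simp add: algebra_simps)
    then have "E s = (c * exp (p * s) - d * exp (q * s)) / (p - q)"
      using \<open>p \<noteq> q\<close> by (simp add: eq_divide_eq)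
    then show "f s = 0"
      by (simp add: f_def P_def Q_def diff_divide_distrib)
  qed
  then show ?thesis by (intro that[of P Q]) (simp add: f_def)
qed

text \<open>A Gronwall argument run backwards from the terminal point: the weight
  \<open>exp (2 * M * t)\<close> outgrows any decay of the squared solution, and only the bound
  \<open>M\<close> on \<open>p\<close> enters, not an antiderivative.\<close>

lemma linear_homogeneous_terminal_zero:
  fixes d p :: "real \<Rightarrow> real"
  assumes der: "\<And>t. t \<in> {a..b} \<Longrightarrow> (d has_real_derivative p t * d t) (at t within {a..b})"
    and bound: "\<And>t. t \<in> {a..b} \<Longrightarrow> \<bar>p t\<bar> \<le> M"
    and "d b = 0" and t: "t \<in> {a..b}"
  shows "d t = 0"
proof -
  define w where "w = (\<lambda>t. (d t)\<^sup>2 * exp (2 * M * t))"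
  have dw: "(w has_real_derivative 2 * (p s + M) * w s) (at s within {a..b})" if s: "s \<in> {a..b}" for s
    unfolding w_def
    by (auto intro!: derivative_eq_intros der[OF s] simp: power2_eq_square algebra_simps)
  have "w t \<le> w b"
  \<comment> \<open>Two-sided derivatives exist only in the interior; at the endpoints continuity of
    \<open>w\<close> is enough for this monotonicity criterion.\<close>
  proof (rule DERIV_nonneg_imp_increasing_open[of t b w])
    show "t \<le> b" using t by simp
    show "\<exists>y. DERIV w s :> y \<and> 0 \<le> y" if "t < s" "s < b" for s
    proof (intro exI conjI)
      have s: "s \<in> {a..b}" using that t by auto
      show "DERIV w s :> 2 * (p s + M) * w s"
        using dw[OF s] at_within_Icc_at[of a s b] that t by auto
      show "0 \<le> 2 * (p s + M) * w s"
        using bound[OF s] by (auto simp: w_def intro!: mult_nonneg_nonneg)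
    qed
    have "continuous_on {a..b} w"
      using dw by (rule DERIV_continuous_on)
    then show "continuous_on {t..b} w"
      by (rule continuous_on_subset) (use t in auto)
  qed
  then have "(d t)\<^sup>2 * exp (2 * M * t) \<le> 0" using \<open>d b = 0\<close> by (simp add: w_def)
  then show ?thesis by (simp add: mult_le_0_iff)
qed

section \<open>Roots of the characteristic polynomial\<close>

context
  fixes \<kappa> \<phi> :: real
  assumes kappa_pos: "\<kappa> > 0" and phi_pos: "\<phi> > 0"
begin

lemma kappa_theta: "\<kappa> * theta \<kappa> \<phi> \<alpha> = sqrt (\<kappa> * \<phi> + \<alpha>\<^sup>2 / 16)"
  using kappa_pos by (simp add: theta_def)

lemma theta_pos: "theta \<kappa> \<phi> \<alpha> > 0"
  using kappa_pos phi_pos by (simp add: theta_def add_pos_nonneg)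

lemma kappa_theta_squared: "(\<kappa> * theta \<kappa> \<phi> \<alpha>)\<^sup>2 = \<kappa> * \<phi> + \<alpha>\<^sup>2 / 16"
  unfolding kappa_theta using kappa_pos phi_pos by (intro real_sqrt_pow2) simp

text \<open>After squaring, the two sides differ by \<open>\<kappa> * \<phi>\<close>, which is
  positive. The bound lets the \<open>cosh\<close> term of \<open>a_denom\<close> absorb the term
  with \<open>\<alpha>\<close>, whatever the sign of \<open>\<alpha>\<close>.\<close>

lemma kappa_theta_gt: "\<bar>\<alpha>\<bar> / 4 < \<kappa> * theta \<kappa> \<phi> \<alpha>"
proof (rule power2_less_imp_less)
  show "(\<bar>\<alpha>\<bar> / 4)\<^sup>2 < (\<kappa> * theta \<kappa> \<phi> \<alpha>)\<^sup>2"
    unfolding kappa_theta_squared using kappa_pos phi_pos by (simp add: power_divide)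
  show "0 \<le> \<kappa> * theta \<kappa> \<phi> \<alpha>"
    using kappa_pos theta_pos[of \<alpha>] by simp
qed

lemma r_plus_add_r_minus: "r_plus \<kappa> \<phi> \<alpha> + r_minus \<kappa> \<phi> \<alpha> = - \<alpha> / (2 * \<kappa>)"
  by (simp add: r_plus_def r_minus_def)

lemma r_plus_times_r_minus: "r_plus \<kappa> \<phi> \<alpha> * r_minus \<kappa> \<phi> \<alpha> = - \<phi> / \<kappa>"
proof -
  have "r_plus \<kappa> \<phi> \<alpha> * r_minus \<kappa> \<phi> \<alpha> = (\<alpha>\<^sup>2 / 16 - (\<kappa> * theta \<kappa> \<phi> \<alpha>)\<^sup>2) / \<kappa>\<^sup>2"
    using kappa_pos by (simp add: r_plus_def r_minus_def field_simps power2_eq_square)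
  also have "\<dots> = - \<phi> / \<kappa>"
    unfolding kappa_theta_squared using kappa_pos by (simp add: power2_eq_square)
  finally show ?thesis .
qed

lemma r_minus_less_r_plus: "r_minus \<kappa> \<phi> \<alpha> < r_plus \<kappa> \<phi> \<alpha>"
  using theta_pos[of \<alpha>] by (simp add: r_plus_def r_minus_def)

text \<open>By the formulas for the sum and product of the roots, the polynomial is
  \<open>2 * \<kappa>\<close> times the product of its two linear factors.\<close>

lemma characteristic_root:
  assumes "r = r_plus \<kappa> \<phi> \<alpha> \<or> r = r_minus \<kappa> \<phi> \<alpha>"
  shows "2 * \<kappa> * r\<^sup>2 + \<alpha> * r - 2 * \<phi> = 0"
proof -
  have "(r - r_plus \<kappa> \<phi> \<alpha>) * (r - r_minus \<kappa> \<phi> \<alpha>) = 0" using assms by auto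
  then have quad: "r\<^sup>2 - (r_plus \<kappa> \<phi> \<alpha> + r_minus \<kappa> \<phi> \<alpha>) * r + r_plus \<kappa> \<phi> \<alpha> * r_minus \<kappa> \<phi> \<alpha> = 0"
    by (simp add: algebra_simps power2_eq_square)
  have "2 * \<kappa> * r\<^sup>2 + \<alpha> * r - 2 * \<phi> = 2 * \<kappa> * (r\<^sup>2 - (- \<alpha> / (2 * \<kappa>)) * r + (- \<phi> / \<kappa>))"
    using kappa_pos by (simp add: algebra_simps)
  also have "\<dots> = 0"
    using quad unfolding r_plus_add_r_minus r_plus_times_r_minus by simp
  finally show ?thesis .
qed

section \<open>The denominator of \<open>a\<close> and the boundary conditions\<close>

text \<open>Since \<open>\<alpha> / 4\<close> is below \<open>\<kappa> * theta\<close> and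
  \<open>sinh\<close> is below \<open>cosh\<close>, the first two terms have a nonnegative sum; the
  term with \<open>A\<close> makes the total strictly positive.\<close>

lemma a_denom_pos:
  assumes "A > 0" and "T > 0"
  shows "a_denom \<kappa> \<phi> A T \<alpha> > 0"
proof -
  define s where "s = sinh (theta \<kappa> \<phi> \<alpha> * T)"
  define c where "c = cosh (theta \<kappa> \<phi> \<alpha> * T)"
  have s: "s > 0" using theta_pos[of \<alpha>] \<open>T > 0\<close> by (simp add: s_def)
  have "s < c" by (simp add: s_def c_def sinh_less_cosh_real)
  have "\<alpha> / 4 * s \<le> \<kappa> * theta \<kappa> \<phi> \<alpha> * s"
    using kappa_theta_gt[of \<alpha>] s by (intro mult_right_mono) auto
  also have "\<dots> \<le> \<kappa> * theta \<kappa> \<phi> \<alpha> * c"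
    using kappa_theta_gt[of \<alpha>] \<open>s < c\<close> by (intro mult_left_mono) auto
  finally have "0 \<le> - (\<alpha> / 2) * s + 2 * \<kappa> * theta \<kappa> \<phi> \<alpha> * c" by simp
  moreover have "0 < 2 * A * s" using \<open>A > 0\<close> s by simp
  ultimately show ?thesis unfolding a_denom_def s_def[symmetric] c_def[symmetric] by simp
qed

text \<open>The functional sending \<open>E\<close> to \<open>\<kappa> * E' T + A * E T\<close>
  takes the value \<open>(\<kappa> * r + A) * exp (r * T)\<close> on \<open>exp (r * t)\<close>. The
  right side is therefore, up to sign, the determinant of the boundary system for the two
  coefficients; the exponential on the left is the factor common to both modes.\<close>

lemma a_denom_eq_boundary_determinant:
  "a_denom \<kappa> \<phi> A T \<alpha> * exp (- \<alpha> / (4 * \<kappa>) * T) =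
     (\<kappa> * r_plus \<kappa> \<phi> \<alpha> + A) * exp (r_plus \<kappa> \<phi> \<alpha> * T)
     - (\<kappa> * r_minus \<kappa> \<phi> \<alpha> + A) * exp (r_minus \<kappa> \<phi> \<alpha> * T)"
proof -
  define x where "x = exp (theta \<kappa> \<phi> \<alpha> * T)"
  define y where "y = exp (- (theta \<kappa> \<phi> \<alpha> * T))"
  define z where "z = exp (- \<alpha> / (4 * \<kappa>) * T)"
  have exps: "exp (r_plus \<kappa> \<phi> \<alpha> * T) = z * x" "exp (r_minus \<kappa> \<phi> \<alpha> * T) = z * y"
    by (simp_all add: r_plus_def r_minus_def x_def y_def z_def flip: exp_add) (simp_all add: algebra_simps)
  have roots: "\<kappa> * r_plus \<kappa> \<phi> \<alpha> = \<kappa> * theta \<kappa> \<phi> \<alpha> - \<alpha> / 4"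
    "\<kappa> * r_minus \<kappa> \<phi> \<alpha> = - \<kappa> * theta \<kappa> \<phi> \<alpha> - \<alpha> / 4"
    using kappa_pos by (simp_all add: r_plus_def r_minus_def field_simps)
  have hyp: "sinh (theta \<kappa> \<phi> \<alpha> * T) = (x - y) / 2" "cosh (theta \<kappa> \<phi> \<alpha> * T) = (x + y) / 2"
    by (simp_all add: sinh_field_def cosh_field_def x_def y_def)
  show ?thesis
    unfolding a_denom_def exps roots hyp z_def[symmetric] by (simp add: field_simps)
qed

text \<open>With coefficients \<open>P\<close> and \<open>E0 - P\<close> the initial condition holds
  automatically, and the left side is the terminal condition. One direction serves existence, the
  other uniqueness.\<close>

lemma boundary_condition_iff:
  assumes "A > 0" and "T > 0"
  shows "P * ((\<kappa> * r_plus \<kappa> \<phi> \<alpha> + A) * exp (r_plus \<kappa> \<phi> \<alpha> * T))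
         + (E0 - P) * ((\<kappa> * r_minus \<kappa> \<phi> \<alpha> + A) * exp (r_minus \<kappa> \<phi> \<alpha> * T)) = 0
       \<longleftrightarrow> P = E0 * a_coeff \<kappa> \<phi> A T \<alpha>" (is "?L = 0 \<longleftrightarrow> _")
proof -
  define D where "D = a_denom \<kappa> \<phi> A T \<alpha>"
  define z where "z = exp (- \<alpha> / (4 * \<kappa>) * T)"
  \<comment> \<open>This is the numerator of \<open>a_coeff\<close>; it comes from the
    \<open>r_minus\<close> mode at \<open>T\<close> after removing the common factor
    \<open>z\<close>.\<close>
  define n where "n = (\<alpha> / 4 + \<kappa> * theta \<kappa> \<phi> \<alpha> - A) * exp (- theta \<kappa> \<phi> \<alpha> * T)"
  have D: "D > 0" using a_denom_pos[OF assms] by (simp add: D_def)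
  have z: "z > 0" by (simp add: z_def)
  have exp_minus_root: "exp (r_minus \<kappa> \<phi> \<alpha> * T) = exp (- theta \<kappa> \<phi> \<alpha> * T) * z"
    by (simp add: r_minus_def z_def algebra_simps flip: exp_add)
  have minus_root: "\<kappa> * r_minus \<kappa> \<phi> \<alpha> + A = - (\<alpha> / 4 + \<kappa> * theta \<kappa> \<phi> \<alpha> - A)"
    using kappa_pos by (simp add: r_minus_def field_simps)
  have minus: "(\<kappa> * r_minus \<kappa> \<phi> \<alpha> + A) * exp (r_minus \<kappa> \<phi> \<alpha> * T) = - n * z"
    unfolding n_def exp_minus_root minus_root by (simp only: mult_minus_left mult.assoc)
  have "?L = P * (D * z) + E0 * ((\<kappa> * r_minus \<kappa> \<phi> \<alpha> + A) * exp (r_minus \<kappa> \<phi> \<alpha> * T))"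
    unfolding D_def z_def a_denom_eq_boundary_determinant by (simp add: algebra_simps)
  also have "\<dots> = (P * D - E0 * n) * z"
    unfolding minus by (simp add: algebra_simps)
  finally have "?L = 0 \<longleftrightarrow> P * D = E0 * n" using z by simp
  also have "\<dots> \<longleftrightarrow> P = E0 * a_coeff \<kappa> \<phi> A T \<alpha>"
    using D unfolding a_coeff_def D_def[symmetric] n_def[symmetric] by (auto simp: eq_divide_eq)
  finally show ?thesis .
qed

section \<open>Existence and uniqueness for the boundary value problem\<close>

lemma inventory_eq:
  "inventory \<kappa> \<phi> A T E0 \<alpha> t =
     E0 * a_coeff \<kappa> \<phi> A T \<alpha> * exp (r_plus \<kappa> \<phi> \<alpha> * t)
     + (E0 - E0 * a_coeff \<kappa> \<phi> A T \<alpha>) * exp (r_minus \<kappa> \<phi> \<alpha> * t)"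
  by (simp add: inventory_def algebra_simps)

lemma inventory_solves_bvp:
  assumes "A > 0" and "T > 0"
  shows "solves_inventory_bvp \<kappa> \<phi> A T E0 \<alpha> (inventory \<kappa> \<phi> A T E0 \<alpha>)"
proof -
  define p where "p = r_plus \<kappa> \<phi> \<alpha>"
  define q where "q = r_minus \<kappa> \<phi> \<alpha>"
  define P where "P = E0 * a_coeff \<kappa> \<phi> A T \<alpha>"
  define Q where "Q = E0 - P"
  define E where "E = (\<lambda>t. P * exp (p * t) + Q * exp (q * t))"
  define E' where "E' = (\<lambda>t. P * p * exp (p * t) + Q * q * exp (q * t))"
  define E'' where "E'' = (\<lambda>t. P * p\<^sup>2 * exp (p * t) + Q * q\<^sup>2 * exp (q * t))"
  have inv: "inventory \<kappa> \<phi> A T E0 \<alpha> = E"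
    by (simp add: E_def P_def Q_def p_def q_def inventory_eq fun_eq_iff)
  \<comment> \<open>An arbitrary \<open>S\<close> covers both the one-sided derivative at
    \<open>T\<close> and the two-sided ones inside.\<close>
  have dE: "(E has_real_derivative E' t) (at t within S)" for t S
    unfolding E_def E'_def by (auto intro!: derivative_eq_intros)
  have dE': "(E' has_real_derivative E'' t) (at t within S)" for t S
    unfolding E'_def E''_def by (auto intro!: derivative_eq_intros simp: power2_eq_square)
  have "2 * \<kappa> * E'' t + \<alpha> * E' t - 2 * \<phi> * E t =
      P * exp (p * t) * (2 * \<kappa> * p\<^sup>2 + \<alpha> * p - 2 * \<phi>)
      + Q * exp (q * t) * (2 * \<kappa> * q\<^sup>2 + \<alpha> * q - 2 * \<phi>)" for t
    by (simp add: E_def E'_def E''_def algebra_simps)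
  then have ode: "0 = 2 * \<kappa> * E'' t + \<alpha> * E' t - 2 * \<phi> * E t" for t
    using characteristic_root[of p \<alpha>] characteristic_root[of q \<alpha>] by (simp add: p_def q_def)
  have "\<kappa> * E' T + A * E T = P * ((\<kappa> * p + A) * exp (p * T)) + Q * ((\<kappa> * q + A) * exp (q * T))"
    by (simp add: E_def E'_def algebra_simps)
  also have "\<dots> = 0"
    using boundary_condition_iff[OF assms, of P \<alpha> E0] by (simp add: P_def Q_def p_def q_def)
  finally have bc: "\<kappa> * E' T + A * E T = 0" .
  have "continuous_on {0..T} E" unfolding E_def by (intro continuous_intros)
  moreover have "E 0 = E0" by (simp add: E_def Q_def)
  ultimately show ?thesis
    unfolding solves_inventory_bvp_def inv using dE dE' ode bc by blast
qed

lemma inventory_bvp_unique: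
  assumes "A > 0" and "T > 0" and sol: "solves_inventory_bvp \<kappa> \<phi> A T E0 \<alpha> E"
    and t: "t \<in> {0..T}"
  shows "E t = inventory \<kappa> \<phi> A T E0 \<alpha> t"
proof -
  define p where "p = r_plus \<kappa> \<phi> \<alpha>"
  define q where "q = r_minus \<kappa> \<phi> \<alpha>"
  obtain E' E'' where cont: "continuous_on {0..T} E"
    and dE: "\<And>t. t \<in> {0<..T} \<Longrightarrow> (E has_real_derivative E' t) (at t within {0..T})"
    and dE': "\<And>t. t \<in> {0<..<T} \<Longrightarrow> (E' has_real_derivative E'' t) (at t)"
    and ode: "\<And>t. t \<in> {0<..<T} \<Longrightarrow> 0 = 2 * \<kappa> * E'' t + \<alpha> * E' t - 2 * \<phi> * E t"
    and bc0: "E 0 = E0" and bcT: "\<kappa> * E' T + A * E T = 0"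
    using sol unfolding solves_inventory_bvp_def by blast
  have dE_open: "(E has_real_derivative E' t) (at t)" if "t \<in> {0<..<T}" for t
    using dE[of t] at_within_Icc_at[of 0 t T] that by auto
  have ode': "E'' t = (p + q) * E' t - p * q * E t" if "t \<in> {0<..<T}" for t
    using ode[OF that] kappa_pos
    unfolding p_def q_def r_plus_add_r_minus r_plus_times_r_minus
    by (simp add: field_simps)
  have "p \<noteq> q" using r_minus_less_r_plus[of \<alpha>] by (simp add: p_def q_def)
  then obtain P Q where E: "\<And>t. t \<in> {0..T} \<Longrightarrow> E t = P * exp (p * t) + Q * exp (q * t)"
    using second_order_solution_exp[OF \<open>T > 0\<close> _ cont dE_open dE' ode'] by blast
  have Q: "Q = E0 - P" using E[of 0] bc0 \<open>T > 0\<close> by simp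
  have ET: "E T = P * exp (p * T) + Q * exp (q * T)" using E[of T] \<open>T > 0\<close> by simp
  \<comment> \<open>The exponential formula holds on all of \<open>{0..T}\<close>, so it may be
    differentiated at \<open>T\<close> within that interval; the radius 1 in the transfer rule is
    arbitrary.\<close>
  have "(E has_real_derivative P * p * exp (p * T) + Q * q * exp (q * T)) (at T within {0..T})"
  proof (rule has_field_derivative_transform_within[OF _ zero_less_one])
    show "((\<lambda>t. P * exp (p * t) + Q * exp (q * t)) has_real_derivative
        P * p * exp (p * T) + Q * q * exp (q * T)) (at T within {0..T})"
      by (auto intro!: derivative_eq_intros)
  qed (use E \<open>T > 0\<close> in auto)
  then have E'T: "E' T = P * p * exp (p * T) + Q * q * exp (q * T)"
    using has_real_derivative_unique_right_endpoint[OF \<open>T > 0\<close>] dE[of T] \<open>T > 0\<close> by auto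
  have "P * ((\<kappa> * p + A) * exp (p * T)) + (E0 - P) * ((\<kappa> * q + A) * exp (q * T)) = \<kappa> * E' T + A * E T"
    unfolding E'T ET Q by (simp add: algebra_simps)
  then have "P = E0 * a_coeff \<kappa> \<phi> A T \<alpha>"
    using boundary_condition_iff[OF \<open>A > 0\<close> \<open>T > 0\<close>, of P \<alpha> E0] bcT by (simp add: p_def q_def)
  then show ?thesis
    using E[OF t] unfolding inventory_eq Q p_def q_def by simp
qed

section \<open>The Riccati equation\<close>

text \<open>With \<open>x = A / sqrt (\<kappa> * \<phi>)\<close>, the left side is
  \<open>(x - 1) / (1 + x)\<close> times an exponential that lies in the interval from 0 to 1
  because \<open>t \<le> T\<close>. Hence \<open>h2\<close> does not blow up before
  \<open>T\<close>.\<close>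

lemma h2_denominator_pos:
  assumes "A > 0" and "t \<le> T"
  shows "c2 \<kappa> \<phi> A T * exp (h2_rate \<kappa> \<phi> * t) < 1"
proof -
  define x where "x = A / sqrt (\<kappa> * \<phi>)"
  define e where "e = exp (h2_rate \<kappa> \<phi> * (t - T))"
  have x: "x > 0" using kappa_pos phi_pos \<open>A > 0\<close> by (simp add: x_def)
  have "h2_rate \<kappa> \<phi> \<ge> 0" using kappa_pos phi_pos by (simp add: h2_rate_def)
  then have e: "0 < e" "e \<le> 1"
    using \<open>t \<le> T\<close> by (simp_all add: e_def mult_nonneg_nonpos)
  have "c2 \<kappa> \<phi> A T * exp (h2_rate \<kappa> \<phi> * t) = (x - 1) / (1 + x) * e"
    unfolding c2_def x_def[symmetric] e_def
    by (simp add: right_diff_distrib exp_diff exp_minus divide_simps) (simp add: algebra_simps)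
  moreover have "(x - 1) * e < 1 + x"
  proof (cases "x \<le> 1")
    case True
    then have "(x - 1) * e \<le> 0" using e by (intro mult_nonpos_nonneg) auto
    then show ?thesis using x by linarith
  next
    case False
    then have "(x - 1) * e \<le> x - 1" using e by (intro mult_left_le) auto
    then show ?thesis by linarith
  qed
  ultimately show ?thesis using x by simp
qed

text \<open>\<open>h2\<close> is a fractional linear function of
  \<open>y t = c * exp (r * t)\<close>, which satisfies \<open>y' = r * y\<close>. Together with
  \<open>\<kappa> * r = 2 * s\<close>, the equation becomes a polynomial identity in
  \<open>y\<close>.\<close>

lemma h2_solves:
  assumes "A > 0"
  shows "solves_h2_equation \<kappa> \<phi> A T (h2 \<kappa> \<phi> A T)"
proof -
  define s where "s = sqrt (\<kappa> * \<phi>)"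
  define r where "r = h2_rate \<kappa> \<phi>"
  define c where "c = c2 \<kappa> \<phi> A T"
  have s: "s > 0" "s\<^sup>2 = \<kappa> * \<phi>" using kappa_pos phi_pos by (auto simp: s_def)
  have ratio: "sqrt (\<phi> / \<kappa>) = s / \<kappa>"
    using kappa_pos phi_pos by (intro real_sqrt_unique) (auto simp: s_def power_divide power2_eq_square)
  have r: "\<kappa> * r = 2 * s"
    using kappa_pos unfolding r_def h2_rate_def ratio by simp
  define y where "y = (\<lambda>t. c * exp (r * t))"
  have h2_eq: "h2 \<kappa> \<phi> A T = (\<lambda>t. 2 * s * ((1 + y t) / (1 - y t)))"
    by (simp add: h2_def s_def y_def r_def c_def fun_eq_iff)
  have y: "y t < 1" if "t \<le> T" for t
    using h2_denominator_pos[OF \<open>A > 0\<close> that] by (simp add: y_def c_def r_def)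
  have dy: "(y has_real_derivative r * y t) (at t within S)" for t S
    unfolding y_def by (auto intro!: derivative_eq_intros)
  \<comment> \<open>The quotient rule applied to \<open>(1 + y) / (1 - y)\<close>, combined with
    \<open>y' = r * y\<close>.\<close>
  define h' where "h' = (\<lambda>t. 4 * s * r * y t / (1 - y t)\<^sup>2)"
  have "(h2 \<kappa> \<phi> A T has_real_derivative h' t) (at t within {0..T})
      \<and> 4 * \<kappa> * \<phi> = - 2 * \<kappa> * h' t + (h2 \<kappa> \<phi> A T t)\<^sup>2" if "t \<in> {0..T}" for t
  proof
    have y1: "1 - y t \<noteq> 0" using y[of t] that by auto
    show "(h2 \<kappa> \<phi> A T has_real_derivative h' t) (at t within {0..T})"
      unfolding h2_eq h'_def using y1
      by (auto intro!: derivative_eq_intros dy simp: field_simps power2_eq_square)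
    have "- 2 * \<kappa> * h' t = - 8 * s * (\<kappa> * r) * y t / (1 - y t)\<^sup>2" by (simp add: h'_def)
    also have "\<dots> = - 16 * s\<^sup>2 * y t / (1 - y t)\<^sup>2" unfolding r by (simp add: power2_eq_square)
    finally have "- 2 * \<kappa> * h' t + (h2 \<kappa> \<phi> A T t)\<^sup>2 =
        - 16 * s\<^sup>2 * y t / (1 - y t)\<^sup>2 + (2 * s * ((1 + y t) / (1 - y t)))\<^sup>2"
      unfolding h2_eq by simp
    also have "\<dots> = (- 16 * s\<^sup>2 * y t + 4 * s\<^sup>2 * (1 + y t)\<^sup>2) / (1 - y t)\<^sup>2"
      by (simp add: power_mult_distrib power_divide add_divide_distrib[where a = "- 16 * s\<^sup>2 * y t"] del: mult_minus_left)
    \<comment> \<open>The identity \<open>(1 + y)\<^sup>2 - 4 * y = (1 - y)\<^sup>2\<close> cancels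
      the denominator and leaves the constant \<open>4 * s\<^sup>2\<close>.\<close>
    also have "- 16 * s\<^sup>2 * y t + 4 * s\<^sup>2 * (1 + y t)\<^sup>2 = 4 * s\<^sup>2 * (1 - y t)\<^sup>2"
      by (simp add: power2_eq_square algebra_simps)
    finally show "4 * \<kappa> * \<phi> = - 2 * \<kappa> * h' t + (h2 \<kappa> \<phi> A T t)\<^sup>2" using y1 s by simp
  qed
  moreover have "h2 \<kappa> \<phi> A T T = 2 * A"
  proof -
    have "y T = - ((1 - A / s) / (1 + A / s))"
      by (simp add: y_def c_def c2_def s_def r_def exp_minus)
    also have "\<dots> = (A - s) / (A + s)"
      using s \<open>A > 0\<close> by (simp add: divide_simps) (simp add: algebra_simps)
    finally have yT: "y T = (A - s) / (A + s)" .
    have "1 + y T = 2 * A / (A + s)" "1 - y T = 2 * s / (A + s)"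
      unfolding yT using s \<open>A > 0\<close> by (simp_all add: field_simps)
    then show ?thesis unfolding h2_eq using s \<open>A > 0\<close> by simp
  qed
  ultimately show ?thesis unfolding solves_h2_equation_def by blast
qed

lemma h2_equation_unique:
  assumes g: "solves_h2_equation \<kappa> \<phi> A T g" and h: "solves_h2_equation \<kappa> \<phi> A T h"
    and t: "t \<in> {0..T}"
  shows "g t = h t"
proof -
  obtain g' where dg: "\<And>t. t \<in> {0..T} \<Longrightarrow> (g has_real_derivative g' t) (at t within {0..T})"
    and g_ode: "\<And>t. t \<in> {0..T} \<Longrightarrow> 4 * \<kappa> * \<phi> = - 2 * \<kappa> * g' t + (g t)\<^sup>2"
    using g unfolding solves_h2_equation_def by blast
  obtain h' where dh: "\<And>t. t \<in> {0..T} \<Longrightarrow> (h has_real_derivative h' t) (at t within {0..T})"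
    and h_ode: "\<And>t. t \<in> {0..T} \<Longrightarrow> 4 * \<kappa> * \<phi> = - 2 * \<kappa> * h' t + (h t)\<^sup>2"
    using h unfolding solves_h2_equation_def by blast
  \<comment> \<open>Subtracting the two equations turns the difference of squares into
    \<open>(g + h) * (g - h)\<close>, so the difference solves a linear equation with this
    coefficient.\<close>
  define p where "p = (\<lambda>t. (g t + h t) / (2 * \<kappa>))"
  have "continuous_on {0..T} g" "continuous_on {0..T} h"
    using dg dh by (blast intro: DERIV_continuous_on)+
  then have "continuous_on {0..T} (\<lambda>t. \<bar>p t\<bar>)"
    unfolding p_def using kappa_pos by (intro continuous_intros) auto
  moreover have "{0..T} \<noteq> {}" using t by auto
  \<comment> \<open>Compactness supplies the bound: \<open>m\<close> is a point where
    \<open>\<bar>p\<bar>\<close> is maximal, and \<open>\<bar>p m\<bar>\<close> serves as the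
    constant \<open>M\<close>.\<close>
  ultimately obtain m where m: "\<And>s. s \<in> {0..T} \<Longrightarrow> \<bar>p s\<bar> \<le> \<bar>p m\<bar>"
    using continuous_attains_sup[OF compact_Icc] by blast
  have "g t - h t = 0"
  proof (rule linear_homogeneous_terminal_zero[OF _ m _ t])
    show "g T - h T = 0" using g h by (simp add: solves_h2_equation_def)
    fix s assume s: "s \<in> {0..T}"
    have "2 * \<kappa> * (g' s - h' s) = (g s + h s) * (g s - h s)"
      using g_ode[OF s] h_ode[OF s] by (simp add: algebra_simps power2_eq_square)
    then have "g' s - h' s = p s * (g s - h s)"
      using kappa_pos by (simp add: p_def field_simps)
    then show "((\<lambda>t. g t - h t) has_real_derivative p s * (g s - h s)) (at s within {0..T})"
      using DERIV_diff[OF dg[OF s] dh[OF s]] by simp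
  qed
  then show ?thesis by simp
qed

end

theorem proposition3p1:
  fixes \<kappa> \<phi> A T E0 \<alpha> :: real
  assumes "\<kappa> > 0" and "\<phi> > 0" and "A > 0" and "T > 0"
  shows "a_denom \<kappa> \<phi> A T \<alpha> > 0
    \<and> solves_inventory_bvp \<kappa> \<phi> A T E0 \<alpha> (inventory \<kappa> \<phi> A T E0 \<alpha>)
    \<and> (\<forall>E. solves_inventory_bvp \<kappa> \<phi> A T E0 \<alpha> E \<longrightarrow>
            (\<forall>t\<in>{0..T}. E t = inventory \<kappa> \<phi> A T E0 \<alpha> t))
    \<and> solves_h2_equation \<kappa> \<phi> A T (h2 \<kappa> \<phi> A T)
    \<and> (\<forall>h. solves_h2_equation \<kappa> \<phi> A T h \<longrightarrow>
            (\<forall>t\<in>{0..T}. h t = h2 \<kappa> \<phi> A T t))"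
proof (intro conjI allI impI ballI)
  show "a_denom \<kappa> \<phi> A T \<alpha> > 0"
    using assms by (intro a_denom_pos)
  show "solves_inventory_bvp \<kappa> \<phi> A T E0 \<alpha> (inventory \<kappa> \<phi> A T E0 \<alpha>)"
    using assms by (intro inventory_solves_bvp)
  show "E t = inventory \<kappa> \<phi> A T E0 \<alpha> t"
    if "solves_inventory_bvp \<kappa> \<phi> A T E0 \<alpha> E" and "t \<in> {0..T}" for E t
    using assms that by (intro inventory_bvp_unique)
  show h2: "solves_h2_equation \<kappa> \<phi> A T (h2 \<kappa> \<phi> A T)"
    using assms by (intro h2_solves)
  \<comment> \<open>An arbitrary solution is compared with the explicit one, which has just been
    shown to solve the same terminal value problem.\<close>
  show "h t = h2 \<kappa> \<phi> A T t" if "solves_h2_equation \<kappa> \<phi> A T h" and "t \<in> {0..T}" for h t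
    using assms(1,2) that(1) h2 that(2) by (rule h2_equation_unique)
qed

end
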